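(* If the restricted eigenvalue condition holds with constant $c>1$, i.e. $\chi(c)>0$, then the matrix $A$ satisfies the robust null space property of order $r$ with constants $\gamma=\frac1c$ and $\tau=\frac{1}{\chi(c)}$, and consequently, $A$ has the $(r,\beta(\lambda))$-rSRNSP$(M,\gamma,\tau)$ and the $(r,\beta_{r-1}(\lambda))$-rRNSP$(M,\gamma,\tau)$ for $\beta(\lambda)=\{\beta_0(\lambda),\beta_1(\lambda),\ldots,\beta_{r-1}(\lambda)\}$ and any $M>0$.
   Context: **Setting.** $A\in\mathbb{R}^{m\times n}$ with $m<n$, $e\in\mathbb{R}^m$, $\overline x\in\mathbb{R}^n$ has exactly $r$ nonzero entries with $2\le r\ll n$, $b:=A\overline x+e$, $\lambda>0$, $\varsigma_0\in[0,1)$. **Notation.** $[n]=\{1,\ldots,n\}$; $S^c=[n]\setminus S$; $d_S$ is the subvector of $d$ indexed by $S$; $\|\cdot\|$ is the $\ell_2$ norm, $\|\cdot\|_1$ the $\ell_1$ norm, $\|\cdot\|_\infty$ the $\ell_\infty$ norm; $|x|_k^{\downarrow}$ is the $k$th largest entry of $|x|=(|x_1|,\ldots,|x_n|)^\top$. **Restricted eigenvalue constant.** For $c>0$, $\chi(c):=\min_{S\subset[n],|S|=r}\ \min_{\|d_{S^c}\|_1\le c\|d_S\|_1,\ \|d\|=1}\frac{1}{\sqrt m}\|Ad\|$. The restricted eigenvalue condition with constant $c$ is $\chi(c)>0$. **Robust null space property of order $r$** with constants $\gamma\in(0,1)$, $\tau>0$: for any $S\subset[n]$ with $|S|=r$ and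 any $d\in\mathbb{R}^n$, $\sum_{i\in S}|d_i|\le\gamma\sum_{i\in S^c}|d_i|+\tau\sqrt{r/m}\,\|Ad\|$. **rRNSP (robust restricted null space property).** For $l\in[r]$, $\eta\ge0$, $M>0$, $\gamma\in(0,1)$, $\tau>0$, $A$ has the $(l,\eta)$-rRNSP$(M,\gamma,\tau)$ if for all $I\subset S\subset[n]$ with $|I|=l$, $|S|=r$ and all $d\in\mathbb{R}^n$ with $\|d_{S^c}\|_\infty\ge\eta$, $\sum_{i\in I}\min\{|d_i|,2M-|d_i|\}\le\gamma\sum_{i\in S^c}|d_i|+\tau\sqrt{r/m}\,\|Ad\|$. **rSRNSP (robust sequential restricted null space property).** Let $\alpha=\{\alpha_0,\alpha_1,\ldots,\alpha_{r-1}\}\neq 0$ be a nonincreasing ordered nonnegative array, i.e. $\alpha_0\ge\alpha_1\ge\cdots\ge\alpha_{r-1}\ge0$. For $M>0$, $\gamma\in(0,1)$, $\tau>0$, $A$ has the $(r,\alpha)$-rSRNSP$(M,\gamma,\tau)$ if for all $\emptyset\ne I\subset S\subset[n]$ with $|S|=r$ and all $d\in\mathbb{R}^n$ with $\|d_{S^c}\|_\infty\ge\alpha_{r-|I|}$, the inequality $\sum_{i\in I}\min\{|d_i|,2M-|d_i|\}\le\gamma\sum_{i\in S^c}|d_i|+\tau\sqrt{r/m}\,\|Ad\|$ holds. **The numbers $\beta_k(\lambda)$.** For $k\in[r-1]$, $\beta_k(\lambda):=\min_{x\in\mathbb{R}^n}\{|x|_{k+1}^{\downarrow}:\|Ax-b\|\le\sqrt{\|e\|^2+2m\lambda(1+\varsigma_0)\|\overline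 x\|_1}\}$, and $\beta_0(\lambda):=\min\{\|z\|_\infty: z\in\bigcup_{\|\xi\|_\infty\le\varsigma_0}\mathcal S(\xi)\}$ with $\mathcal S(\xi):=\arg\min_{x\in\mathbb{R}^n}\{\frac{1}{2m}\|Ax-b\|^2+\lambda(\|x\|_1-\langle\xi,x\rangle)\}$. (Then $\beta_0(\lambda)\ge\beta_1(\lambda)\ge\cdots\ge\beta_{r-1}(\lambda)$.)
   Formalization: The formal definition of rSRNSP drops the requirement that the array be nonzero, since for large λ the zero vector lies in S(0) and β(λ) is the zero array, where the paper's notion is undefined; for β(λ)≠0 the statement is the paper's. *)

theory Defs
  imports "HOL-Analysis.Analysis" "HOL-Library.Multiset"
begin

text \<open>
  An \<open>m \<times> n\<close> matrix is an element of \<open>real ^ 'n ^ 'm\<close>, with \<open>m = CARD('m)\<close> and \<open>n = CARD('n)\<close>;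
  \<open>[n]\<close> is the index type \<open>'n\<close> and \<open>-S\<close> is the complement of \<open>S\<close> in \<open>[n]\<close>.
  The Euclidean norm is \<^const>\<open>norm\<close> and the sup norm is \<^const>\<open>infnorm\<close>.
\<close>

definition l1norm :: "real ^ 'n \<Rightarrow> real" where
  "l1norm x = (\<Sum>i\<in>UNIV. \<bar>x $ i\<bar>)"

text \<open>The subvector indexed by \<open>S\<close> is padded with zeros, which changes none of its norms
  (and gives the empty subvector norm 0).\<close>

definition subvec :: "real ^ 'n \<Rightarrow> 'n set \<Rightarrow> real ^ 'n" where
  "subvec d S = (\<chi> i. if i \<in> S then d $ i else 0)"

text \<open>\<open>kth_largest_abs x k\<close> is meant for \<open>1 \<le> k \<le> n\<close>; entries are counted with multiplicity.\<close>

definition kth_largest_abs :: "real ^ 'n \<Rightarrow> nat \<Rightarrow> real" where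
  "kth_largest_abs x k =
     rev (sorted_list_of_multiset (image_mset (\<lambda>i. \<bar>x $ i\<bar>) (mset_set UNIV))) ! (k - 1)"

text \<open>For \<open>1 \<le> r \<le> n\<close> and \<open>c > 0\<close> the inner infimum below is over a nonempty compact set,
  hence it is a minimum.\<close>

definition restricted_eigenvalue :: "real ^ 'n ^ 'm \<Rightarrow> nat \<Rightarrow> real \<Rightarrow> real" where
  "restricted_eigenvalue A r c =
     (MIN S\<in>{S :: 'n set. card S = r}.
        INF d\<in>{d. l1norm (subvec d (-S)) \<le> c * l1norm (subvec d S) \<and> norm d = 1}.
          1 / sqrt (real CARD('m)) * norm (A *v d))"

definition robust_nsp :: "real ^ 'n ^ 'm \<Rightarrow> nat \<Rightarrow> real \<Rightarrow> real \<Rightarrow> bool" where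
  "robust_nsp A r \<gamma> \<tau> \<longleftrightarrow>
     0 < \<gamma> \<and> \<gamma> < 1 \<and> 0 < \<tau> \<and>
     (\<forall>S. card S = r \<longrightarrow> (\<forall>d.
        (\<Sum>i\<in>S. \<bar>d $ i\<bar>)
          \<le> \<gamma> * (\<Sum>i\<in>-S. \<bar>d $ i\<bar>) + \<tau> * sqrt (real r / real CARD('m)) * norm (A *v d)))"

definition rRNSP ::
  "real ^ 'n ^ 'm \<Rightarrow> nat \<Rightarrow> nat \<Rightarrow> real \<Rightarrow> real \<Rightarrow> real \<Rightarrow> real \<Rightarrow> bool" where
  "rRNSP A r l \<eta> M \<gamma> \<tau> \<longleftrightarrow>
     1 \<le> l \<and> l \<le> r \<and> 0 \<le> \<eta> \<and> 0 < M \<and> 0 < \<gamma> \<and> \<gamma> < 1 \<and> 0 < \<tau> \<and>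
     (\<forall>I S. I \<subseteq> S \<longrightarrow> card I = l \<longrightarrow> card S = r \<longrightarrow>
        (\<forall>d. infnorm (subvec d (-S)) \<ge> \<eta> \<longrightarrow>
           (\<Sum>i\<in>I. min \<bar>d $ i\<bar> (2 * M - \<bar>d $ i\<bar>))
             \<le> \<gamma> * (\<Sum>i\<in>-S. \<bar>d $ i\<bar>) + \<tau> * sqrt (real r / real CARD('m)) * norm (A *v d)))"

text \<open>Only the entries \<open>\<alpha> 0, \<dots>, \<alpha> (r - 1)\<close> matter. The array is required to be nonnegative
  and nonincreasing. The zero array, customarily excluded, is allowed here, because the thresholds
  \<open>beta\<close> below can all vanish (for large \<open>lam\<close> the zero vector solves the problem with \<open>\<xi> = 0\<close>);
  for nonzero arrays this makes no difference.\<close>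

definition rSRNSP ::
  "real ^ 'n ^ 'm \<Rightarrow> nat \<Rightarrow> (nat \<Rightarrow> real) \<Rightarrow> real \<Rightarrow> real \<Rightarrow> real \<Rightarrow> bool" where
  "rSRNSP A r \<alpha> M \<gamma> \<tau> \<longleftrightarrow>
     (\<forall>k<r. 0 \<le> \<alpha> k) \<and> (\<forall>j k. j \<le> k \<longrightarrow> k < r \<longrightarrow> \<alpha> k \<le> \<alpha> j) \<and>
     0 < M \<and> 0 < \<gamma> \<and> \<gamma> < 1 \<and> 0 < \<tau> \<and>
     (\<forall>I S. I \<noteq> {} \<longrightarrow> I \<subseteq> S \<longrightarrow> card S = r \<longrightarrow>
        (\<forall>d. infnorm (subvec d (-S)) \<ge> \<alpha> (r - card I) \<longrightarrow>
           (\<Sum>i\<in>I. min \<bar>d $ i\<bar> (2 * M - \<bar>d $ i\<bar>))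
             \<le> \<gamma> * (\<Sum>i\<in>-S. \<bar>d $ i\<bar>) + \<tau> * sqrt (real r / real CARD('m)) * norm (A *v d)))"

definition lasso_solutions ::
  "real ^ 'n ^ 'm \<Rightarrow> real ^ 'm \<Rightarrow> real \<Rightarrow> real ^ 'n \<Rightarrow> (real ^ 'n) set" where
  "lasso_solutions A b lam \<xi> =
     {x. is_arg_min
           (\<lambda>x. 1 / (2 * real CARD('m)) * (norm (A *v x - b))\<^sup>2 + lam * (l1norm x - \<xi> \<bullet> x))
           (\<lambda>_. True) x}"

text \<open>With \<open>b = A *v xbar + e\<close>, \<open>lam > 0\<close> and \<open>0 \<le> sigma0 < 1\<close>, both infima are attained for
  \<open>k < n\<close>. For \<open>k = 0\<close>, the objectives are coercive uniformly in \<open>\<xi>\<close>, so the union of the solution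
  sets is nonempty and compact. For \<open>k > 0\<close>, the value is the least of finitely many minima of
  sup norms of subvectors, each over the same nonempty feasible set.\<close>

definition beta ::
  "real ^ 'n ^ 'm \<Rightarrow> real ^ 'm \<Rightarrow> real ^ 'm \<Rightarrow> real ^ 'n \<Rightarrow> real \<Rightarrow> real \<Rightarrow> nat \<Rightarrow> real" where
  "beta A b e xbar sigma0 lam k =
     (if k = 0
      then (INF z\<in>(\<Union>\<xi>\<in>{\<xi>. infnorm \<xi> \<le> sigma0}. lasso_solutions A b lam \<xi>). infnorm z)
      else (INF x\<in>{x. norm (A *v x - b)
                     \<le> sqrt ((norm e)\<^sup>2 + 2 * real CARD('m) * lam * (1 + sigma0) * l1norm xbar)}.
              kth_largest_abs x (k + 1)))"

end

theory Submission
  imports Defs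
begin

text \<open>
  Fix \<open>S\<close> with \<open>r\<close> elements and a vector \<open>d\<close>. If \<open>d\<close> lies outside the cone
  \<open>\<parallel>d\<^bsub>-S\<^esub>\<parallel>\<^sub>1 \<le> c * \<parallel>d\<^bsub>S\<^esub>\<parallel>\<^sub>1\<close>, the null space inequality holds with the
  first term on the right alone. If \<open>d\<close> lies inside the cone, the restricted eigenvalue bounds
  \<open>norm d\<close> by \<open>norm (A *v d)\<close>, and Cauchy-Schwarz on the \<open>r\<close> entries in \<open>S\<close> bounds
  \<open>\<parallel>d\<^bsub>S\<^esub>\<parallel>\<^sub>1\<close> by \<open>sqrt r * norm d\<close>, so that the second term suffices
  (\<open>restricted_eigenvalue_imp_robust_nsp\<close>).

  The two restricted properties ask for less: the vectors \<open>d\<close> are restricted, the sum runs over a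
  subset of \<open>S\<close>, and \<open>min \<bar>t\<bar> (2 * M - \<bar>t\<bar>) \<le> \<bar>t\<bar>\<close>. What remains is that the thresholds
  \<open>beta\<close> form a nonnegative nonincreasing array. Nonnegativity needs the index sets of the infima
  to be nonempty; for \<open>beta 0\<close> this is the existence of a lasso solution, which holds by coercivity
  (\<open>lasso_solutions_0_nonempty\<close>). Monotonicity from \<open>beta 0\<close> to \<open>beta 1\<close> holds because comparing
  objective values with \<open>xbar\<close> shows every lasso solution to be feasible for the problems that
  define the later thresholds (\<open>lasso_solution_feasible\<close>).
\<close>

section \<open>Norms of vectors and subvectors\<close>

lemma l1norm_nonneg: "0 \<le> l1norm x"
  unfolding l1norm_def by (simp add: sum_nonneg)

lemma l1norm_subvec: "l1norm (subvec d S) = (\<Sum>i\<in>S. \<bar>d $ i\<bar>)"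
proof -
  have "l1norm (subvec d S) = (\<Sum>i\<in>UNIV. if i \<in> S then \<bar>d $ i\<bar> else 0)"
    unfolding l1norm_def subvec_def by (intro sum.cong) auto
  also have "\<dots> = (\<Sum>i\<in>S. \<bar>d $ i\<bar>)"
    by (simp add: sum.If_cases)
  finally show ?thesis .
qed

lemma l1norm_scaleR: "l1norm (a *\<^sub>R x) = \<bar>a\<bar> * l1norm x"
  unfolding l1norm_def by (simp add: abs_mult sum_distrib_left)

lemma subvec_scaleR: "subvec (a *\<^sub>R x) S = a *\<^sub>R subvec x S"
  unfolding subvec_def by (simp add: vec_eq_iff)

lemma continuous_on_l1norm: "continuous_on S l1norm"
  unfolding l1norm_def by (intro continuous_intros)

lemma abs_inner_le_infnorm_l1norm:
  fixes x y :: "real ^ 'n"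
  shows "\<bar>x \<bullet> y\<bar> \<le> infnorm x * l1norm y"
proof -
  have "\<bar>x \<bullet> y\<bar> \<le> (\<Sum>i\<in>UNIV. \<bar>x $ i * y $ i\<bar>)"
    unfolding inner_vec_def by (simp add: sum_abs)
  also have "\<dots> \<le> (\<Sum>i\<in>UNIV. infnorm x * \<bar>y $ i\<bar>)"
    by (intro sum_mono) (simp add: abs_mult mult_right_mono component_le_infnorm_cart)
  finally show ?thesis by (simp add: l1norm_def sum_distrib_left)
qed

lemma sum_abs_le_sqrt_card_norm:
  fixes d :: "real ^ 'n"
  shows "(\<Sum>i\<in>S. \<bar>d $ i\<bar>) \<le> sqrt (real (card S)) * norm d"
proof -
  have "(\<Sum>i\<in>S. \<bar>d $ i\<bar>) \<le> L2_set (\<lambda>_. 1) S * L2_set (($) d) S"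
    using L2_set_mult_ineq[of "\<lambda>_. 1" "($) d" S] by simp
  also have "L2_set (\<lambda>_. 1::real) S = sqrt (real (card S))"
    by (simp add: L2_set_def)
  also have "L2_set (($) d) S \<le> norm d"
    unfolding norm_vec_def L2_set_def real_norm_def power2_abs
    by (intro real_sqrt_le_mono sum_mono2) auto
  finally show ?thesis by (simp add: mult_left_mono)
qed

section \<open>From restricted eigenvalues to null space properties\<close>

text \<open>The definition speaks of unit vectors; both the cone and the inequality are homogeneous.\<close>

lemma restricted_eigenvalue_le:
  fixes A :: "real ^ 'n ^ 'm" and d :: "real ^ 'n"
  assumes "card S = r" and cone: "l1norm (subvec d (-S)) \<le> c * l1norm (subvec d S)"
  shows "restricted_eigenvalue A r c * norm d \<le> 1 / sqrt (real CARD('m)) * norm (A *v d)"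
proof (cases "d = 0")
  case False
  define K where "K = (\<lambda>S. {d :: real ^ 'n.
      l1norm (subvec d (-S)) \<le> c * l1norm (subvec d S) \<and> norm d = 1})"
  let ?f = "\<lambda>d. 1 / sqrt (real CARD('m)) * norm (A *v d)"
  define u where "u = (1 / norm d) *\<^sub>R d"
  have "u \<in> K S"
    using False cone unfolding u_def K_def mem_Collect_eq subvec_scaleR l1norm_scaleR
    by (simp add: divide_right_mono)
  have "restricted_eigenvalue A r c \<le> (INF d\<in>K S. ?f d)"
    unfolding restricted_eigenvalue_def K_def using \<open>card S = r\<close> by (intro Min_le) auto
  also have "\<dots> \<le> ?f u"
    by (rule cINF_lower[OF bdd_belowI2[where m = 0] \<open>u \<in> K S\<close>]) simp
  also have "\<dots> = ?f d / norm d"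
    by (simp add: u_def matrix_vector_mult_scaleR)
  finally show ?thesis
    using False by (simp add: pos_le_divide_eq mult_ac)
qed simp

lemma restricted_eigenvalue_imp_robust_nsp:
  fixes A :: "real ^ 'n ^ 'm"
  assumes "c > 1" and pos: "restricted_eigenvalue A r c > 0"
  shows "robust_nsp A r (1 / c) (1 / restricted_eigenvalue A r c)"
proof -
  let ?\<chi> = "restricted_eigenvalue A r c"
  have "(\<Sum>i\<in>S. \<bar>d $ i\<bar>) \<le> 1 / c * (\<Sum>i\<in>-S. \<bar>d $ i\<bar>)
      + 1 / ?\<chi> * sqrt (real r / real CARD('m)) * norm (A *v d)" (is "?s \<le> 1 / c * ?t + ?w")
    if "card S = r" for S and d :: "real ^ 'n"
  proof (cases "?t \<le> c * ?s")
    case True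
    then have "?\<chi> * norm d \<le> 1 / sqrt (real CARD('m)) * norm (A *v d)"
      using restricted_eigenvalue_le[OF that, of d c A] by (simp add: l1norm_subvec)
    then have "norm d \<le> 1 / ?\<chi> * (1 / sqrt (real CARD('m)) * norm (A *v d))"
      using pos by (simp add: pos_le_divide_eq mult_ac)
    then have "sqrt (real r) * norm d
        \<le> sqrt (real r) * (1 / ?\<chi> * (1 / sqrt (real CARD('m)) * norm (A *v d)))"
      by (rule mult_left_mono) simp
    also have "\<dots> = ?w"
      by (simp add: real_sqrt_divide)
    finally have "?s \<le> ?w"
      using sum_abs_le_sqrt_card_norm[of d S] that by simp
    moreover have "0 \<le> 1 / c * ?t"
      using \<open>c > 1\<close> by (simp add: sum_nonneg)
    ultimately show ?thesis by linarith
  next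
    case False
    then have "?s \<le> 1 / c * ?t"
      using \<open>c > 1\<close> by (simp add: pos_le_divide_eq mult.commute)
    moreover have "0 \<le> ?w" using pos by simp
    ultimately show ?thesis by linarith
  qed
  then show ?thesis
    using assms unfolding robust_nsp_def by simp
qed

lemma robust_nsp_truncated_sum_le:
  fixes A :: "real ^ 'n ^ 'm"
  assumes "robust_nsp A r \<gamma> \<tau>" and "I \<subseteq> S" and "card S = r"
  shows "(\<Sum>i\<in>I. min \<bar>d $ i\<bar> (2 * M - \<bar>d $ i\<bar>))
    \<le> \<gamma> * (\<Sum>i\<in>-S. \<bar>d $ i\<bar>) + \<tau> * sqrt (real r / real CARD('m)) * norm (A *v d)"
proof -
  have "(\<Sum>i\<in>I. min \<bar>d $ i\<bar> (2 * M - \<bar>d $ i\<bar>)) \<le> (\<Sum>i\<in>I. \<bar>d $ i\<bar>)"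
    by (intro sum_mono) simp
  also have "\<dots> \<le> (\<Sum>i\<in>S. \<bar>d $ i\<bar>)"
    using \<open>I \<subseteq> S\<close> by (intro sum_mono2) auto
  also have "\<dots> \<le> \<gamma> * (\<Sum>i\<in>-S. \<bar>d $ i\<bar>)
      + \<tau> * sqrt (real r / real CARD('m)) * norm (A *v d)"
    using assms unfolding robust_nsp_def by blast
  finally show ?thesis .
qed

lemma robust_nsp_imp_rSRNSP:
  assumes "robust_nsp A r \<gamma> \<tau>" and "M > 0"
    and "\<And>k. k < r \<Longrightarrow> 0 \<le> \<alpha> k" and "\<And>j k. j \<le> k \<Longrightarrow> k < r \<Longrightarrow> \<alpha> k \<le> \<alpha> j"
  shows "rSRNSP A r \<alpha> M \<gamma> \<tau>"
  using assms robust_nsp_truncated_sum_le[OF assms(1)]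
  unfolding rSRNSP_def by (simp add: robust_nsp_def)

lemma robust_nsp_imp_rRNSP:
  assumes "robust_nsp A r \<gamma> \<tau>" and "M > 0" and "0 \<le> \<eta>" and "1 \<le> l" and "l \<le> r"
  shows "rRNSP A r l \<eta> M \<gamma> \<tau>"
  using assms robust_nsp_truncated_sum_le[OF assms(1)]
  unfolding rRNSP_def by (simp add: robust_nsp_def)

section \<open>Order statistics of the absolute values\<close>

lemma kth_largest_abs_in_range:
  fixes x :: "real ^ 'n"
  assumes "1 \<le> k" and "k \<le> CARD('n)"
  shows "\<exists>i. kth_largest_abs x k = \<bar>x $ i\<bar>"
proof -
  let ?ys = "rev (sorted_list_of_multiset (image_mset (\<lambda>i. \<bar>x $ i\<bar>) (mset_set UNIV)))"
  have "?ys ! (k - 1) \<in> set ?ys"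
    using assms by (intro nth_mem) (simp flip: size_mset)
  then show ?thesis
    unfolding kth_largest_abs_def by auto
qed

lemma kth_largest_abs_nonneg:
  fixes x :: "real ^ 'n"
  assumes "1 \<le> k" and "k \<le> CARD('n)"
  shows "0 \<le> kth_largest_abs x k"
  using kth_largest_abs_in_range[OF assms, of x] by auto

lemma kth_largest_abs_le_infnorm:
  fixes x :: "real ^ 'n"
  assumes "1 \<le> k" and "k \<le> CARD('n)"
  shows "kth_largest_abs x k \<le> infnorm x"
  using kth_largest_abs_in_range[OF assms, of x] component_le_infnorm_cart[of x] by metis

lemma kth_largest_abs_antimono:
  fixes x :: "real ^ 'n"
  assumes "1 \<le> j" and "j \<le> k" and "k \<le> CARD('n)"
  shows "kth_largest_abs x k \<le> kth_largest_abs x j"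
  unfolding kth_largest_abs_def
  using assms by (intro sorted_rev_nth_mono) (simp_all flip: size_mset)

section \<open>Lasso solutions\<close>

text \<open>The objective at \<open>\<xi> = 0\<close> dominates \<open>lam * norm x\<close>, so outside a large ball it exceeds its
  value at the origin, and a minimizer over the ball is a global one.\<close>

lemma lasso_solutions_0_nonempty:
  fixes A :: "real ^ 'n ^ 'm"
  assumes "lam > 0"
  shows "lasso_solutions A b lam 0 \<noteq> {}"
proof -
  define F where "F = (\<lambda>x :: real ^ 'n.
      1 / (2 * real CARD('m)) * (norm (A *v x - b))\<^sup>2 + lam * (l1norm x - 0 \<bullet> x))"
  have F_ge: "lam * norm x \<le> F x" for x
  proof -
    have "lam * norm x \<le> lam * l1norm x"
      using assms norm_le_l1_cart[of x] by (simp add: l1norm_def)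
    moreover have "0 \<le> 1 / (2 * real CARD('m)) * (norm (A *v x - b))\<^sup>2"
      by simp
    ultimately show ?thesis unfolding F_def inner_zero_left diff_zero by linarith
  qed
  let ?B = "cball 0 (F 0 / lam) :: (real ^ 'n) set"
  have F0: "0 \<le> F 0" using F_ge[of 0] by simp
  have "continuous_on ?B F"
    unfolding F_def
    by (intro continuous_intros continuous_on_l1norm matrix_vector_mult_linear_continuous_on)
  moreover have "?B \<noteq> {}" using F0 assms by (simp add: not_less)
  ultimately obtain x where x: "x \<in> ?B" "\<forall>y\<in>?B. F x \<le> F y"
    using continuous_attains_inf[of ?B F] by auto
  have "F x \<le> F y" for y
  proof (cases "y \<in> ?B")
    case False
    then have "F 0 < lam * norm y"
      using assms by (simp add: not_le pos_divide_less_eq mult.commute)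
    moreover have "F x \<le> F 0" using x F0 assms by simp
    ultimately show ?thesis using F_ge[of y] by linarith
  qed (use x in simp)
  then have "x \<in> lasso_solutions A b lam 0"
    unfolding lasso_solutions_def by (simp add: is_arg_min_linorder F_def)
  then show ?thesis by auto
qed

text \<open>The penalty \<open>\<parallel>z\<parallel>\<^sub>1 - \<xi> \<bullet> z\<close> is nonnegative since \<open>\<parallel>\<xi>\<parallel>\<^sub>\<infinity> \<le> 1\<close>, and is at most
  \<open>(1 + s) * \<parallel>x\<parallel>\<^sub>1\<close> at the point of comparison \<open>x\<close>, whose residual is \<open>e\<close>.\<close>

lemma lasso_solution_feasible:
  fixes A :: "real ^ 'n ^ 'm"
  assumes "b = A *v x + e" and "lam > 0" and "s \<le> 1" and "infnorm \<xi> \<le> s"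
    and z: "z \<in> lasso_solutions A b lam \<xi>"
  shows "norm (A *v z - b)
    \<le> sqrt ((norm e)\<^sup>2 + 2 * real CARD('m) * lam * (1 + s) * l1norm x)"
proof -
  let ?m = "real CARD('m)"
  have inner_le: "\<bar>\<xi> \<bullet> y\<bar> \<le> s * l1norm y" for y
    using abs_inner_le_infnorm_l1norm[of \<xi> y] mult_right_mono[OF assms(4) l1norm_nonneg[of y]]
    by linarith
  have "s * l1norm z \<le> l1norm z"
    using mult_right_mono[OF \<open>s \<le> 1\<close> l1norm_nonneg[of z]] by simp
  then have z_pen: "0 \<le> lam * (l1norm z - \<xi> \<bullet> z)"
    using inner_le[of z] \<open>lam > 0\<close> by simp
  have "l1norm x - \<xi> \<bullet> x \<le> (1 + s) * l1norm x"
    using inner_le[of x] by (simp add: distrib_right)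
  then have x_pen: "lam * (l1norm x - \<xi> \<bullet> x) \<le> lam * ((1 + s) * l1norm x)"
    using \<open>lam > 0\<close> by simp
  have res: "norm (A *v x - b) = norm e"
    using assms(1) by simp
  have "1 / (2 * ?m) * (norm (A *v z - b))\<^sup>2 + lam * (l1norm z - \<xi> \<bullet> z)
      \<le> 1 / (2 * ?m) * (norm (A *v x - b))\<^sup>2 + lam * (l1norm x - \<xi> \<bullet> x)"
    using z unfolding lasso_solutions_def by (simp add: is_arg_min_linorder)
  then have "1 / (2 * ?m) * (norm (A *v z - b))\<^sup>2
      \<le> 1 / (2 * ?m) * (norm e)\<^sup>2 + lam * ((1 + s) * l1norm x)"
    using z_pen x_pen unfolding res by linarith
  then have "(norm (A *v z - b))\<^sup>2 \<le> (norm e)\<^sup>2 + 2 * ?m * lam * (1 + s) * l1norm x"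
    by (simp add: field_simps)
  then show ?thesis by (rule real_le_rsqrt)
qed

section \<open>The thresholds\<close>

context
  fixes A :: "real ^ 'n ^ 'm" and e b :: "real ^ 'm" and xbar :: "real ^ 'n"
    and lam sigma0 :: real
  assumes b: "b = A *v xbar + e" and lam: "lam > 0" and sigma0: "0 \<le> sigma0" "sigma0 \<le> 1"
begin

abbreviation (input) "solutions \<equiv>
  (\<Union>\<xi>\<in>{\<xi>. infnorm \<xi> \<le> sigma0}. lasso_solutions A b lam \<xi>)"

abbreviation (input) "feasible \<equiv> {x. norm (A *v x - b)
  \<le> sqrt ((norm e)\<^sup>2 + 2 * real CARD('m) * lam * (1 + sigma0) * l1norm xbar)}"

lemma solutions_nonempty: "solutions \<noteq> {}"
proof -
  have "infnorm (0 :: real ^ 'n) \<le> sigma0" using sigma0 by (simp add: infnorm_0)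
  then show ?thesis using lasso_solutions_0_nonempty[OF lam, of A b] by blast
qed

lemma solutions_subset_feasible: "solutions \<subseteq> feasible"
  using lasso_solution_feasible[OF b lam sigma0(2)] by blast

lemma feasible_nonempty: "feasible \<noteq> {}"
  using solutions_nonempty solutions_subset_feasible by blast

lemma beta_nonneg:
  assumes "k < CARD('n)"
  shows "0 \<le> beta A b e xbar sigma0 lam k"
proof (cases "k = 0")
  case True
  then show ?thesis
    using cINF_greatest[OF solutions_nonempty infnorm_pos_le] by (simp add: beta_def)
next
  case False
  then show ?thesis
    using cINF_greatest[OF feasible_nonempty, of 0 "\<lambda>x. kth_largest_abs x (k + 1)"] assms
    by (simp add: beta_def kth_largest_abs_nonneg)
qed

lemma beta_le_kth_largest_abs:
  assumes "0 < k" and "k < CARD('n)" and "x \<in> feasible"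
  shows "beta A b e xbar sigma0 lam k \<le> kth_largest_abs x (k + 1)"
proof -
  have "bdd_below ((\<lambda>x. kth_largest_abs x (k + 1)) ` feasible)"
    using assms by (intro bdd_belowI2[where m = 0] kth_largest_abs_nonneg) auto
  from cINF_lower[OF this \<open>x \<in> feasible\<close>] show ?thesis
    using \<open>0 < k\<close> by (simp add: beta_def)
qed

lemma beta_antimono:
  assumes "j \<le> k" and "k < CARD('n)"
  shows "beta A b e xbar sigma0 lam k \<le> beta A b e xbar sigma0 lam j"
proof (cases "k = 0")
  case True
  then show ?thesis using assms by simp
next
  case k: False
  show ?thesis
  proof (cases "j = 0")
    case True
    have "beta A b e xbar sigma0 lam k \<le> infnorm z" if "z \<in> solutions" for z
    proof -
      have "z \<in> feasible" using that solutions_subset_feasible by blast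
      then have "beta A b e xbar sigma0 lam k \<le> kth_largest_abs z (k + 1)"
        using k assms by (intro beta_le_kth_largest_abs) simp_all
      also have "\<dots> \<le> infnorm z"
        using assms by (intro kth_largest_abs_le_infnorm) simp_all
      finally show ?thesis .
    qed
    then have "beta A b e xbar sigma0 lam k \<le> (INF z\<in>solutions. infnorm z)"
      by (rule cINF_greatest[OF solutions_nonempty])
    also have "\<dots> = beta A b e xbar sigma0 lam j"
      using True by (simp add: beta_def)
    finally show ?thesis .
  next
    case False
    have "beta A b e xbar sigma0 lam k \<le> kth_largest_abs x (j + 1)" if "x \<in> feasible" for x
    proof -
      have "beta A b e xbar sigma0 lam k \<le> kth_largest_abs x (k + 1)"
        using k assms that by (intro beta_le_kth_largest_abs) simp_all
      also have "\<dots> \<le> kth_largest_abs x (j + 1)"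
        using assms by (intro kth_largest_abs_antimono) simp_all
      finally show ?thesis .
    qed
    then have "beta A b e xbar sigma0 lam k \<le> (INF x\<in>feasible. kth_largest_abs x (j + 1))"
      by (rule cINF_greatest[OF feasible_nonempty])
    also have "\<dots> = beta A b e xbar sigma0 lam j"
      using False by (simp add: beta_def)
    finally show ?thesis .
  qed
qed

end

section \<open>The null space properties of the lasso\<close>

theorem proposition9:
  fixes A :: "real ^ 'n ^ 'm" and e b :: "real ^ 'm" and xbar :: "real ^ 'n"
    and r :: nat and lam sigma0 c :: real
  assumes "CARD('m) < CARD('n)"
    and "card {i. xbar $ i \<noteq> 0} = r" and "2 \<le> r" and "r < CARD('n)"
    and "b = A *v xbar + e"
    and "lam > 0" and "0 \<le> sigma0" and "sigma0 < 1"
    and "c > 1" and "restricted_eigenvalue A r c > 0"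
  shows "robust_nsp A r (1 / c) (1 / restricted_eigenvalue A r c) \<and>
    (\<forall>M>0.
       rSRNSP A r (beta A b e xbar sigma0 lam) M (1 / c) (1 / restricted_eigenvalue A r c) \<and>
       rRNSP A r r (beta A b e xbar sigma0 lam (r - 1)) M (1 / c) (1 / restricted_eigenvalue A r c))"
proof -
  have nsp: "robust_nsp A r (1 / c) (1 / restricted_eigenvalue A r c)"
    using assms(9,10) by (rule restricted_eigenvalue_imp_robust_nsp)
  have sigma0: "sigma0 \<le> 1" using \<open>sigma0 < 1\<close> by simp
  note beta = beta_nonneg[OF assms(5-7) sigma0] beta_antimono[OF assms(5-7) sigma0]
  have "rSRNSP A r (beta A b e xbar sigma0 lam) M (1 / c) (1 / restricted_eigenvalue A r c)"
    if "M > 0" for M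
    using \<open>r < CARD('n)\<close> by (intro robust_nsp_imp_rSRNSP[OF nsp that] beta) simp_all
  moreover have
    "rRNSP A r r (beta A b e xbar sigma0 lam (r - 1)) M (1 / c) (1 / restricted_eigenvalue A r c)"
    if "M > 0" for M
    using \<open>2 \<le> r\<close> \<open>r < CARD('n)\<close> by (intro robust_nsp_imp_rRNSP[OF nsp that] beta) simp_all
  ultimately show ?thesis using nsp by blast
qed

end
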